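(* Let $G$ be a finite abelian group, let $\Lambda$ be a subgroup of $G\times\widehat{G}$, and let $\tau\in\mathbb{C}^{o(G)}$, $f\in(\mathbb{C}^{o(G)})^*$. If $(\{f(\pi(\lambda)^{-1})\}_{\lambda\in\Lambda},\{\pi(\lambda)\tau\}_{\lambda\in\Lambda})$ is a Gabor-Schauder frame for $\mathbb{C}^{o(G)}$, then both sets $\{\pi(\mu)^{-1}\tau\}_{\mu\in\Lambda^0}$ (in $\mathbb{C}^{o(G)}$) and $\{f(\pi(\mu)^{-1})\}_{\mu\in\Lambda^0}$ (in $(\mathbb{C}^{o(G)})^*$) are linearly independent.
   Context: $G$ is a finite abelian group (written additively), $o(G)$ is its order, and $\widehat{G}$ is its group of characters. $\mathbb{C}^{o(G)}$ is the space of vectors $(x_g)_{g\in G}$ and $(\mathbb{C}^{o(G)})^*$ is the space of linear functionals on it. For $\lambda=(k,\xi)\in G\times\widehat{G}$ the time-frequency shift operator $\pi(\lambda):\mathbb{C}^{o(G)}\to\mathbb{C}^{o(G)}$ is $\pi(\lambda)(x_g)_{g\in G}=(\xi(g)x_{g-k})_{g\in G}$; it is invertible. $f(\pi(\lambda)^{-1})$ denotes the functional $x\mapsto f(\pi(\lambda)^{-1}x)$. For a subgroup $\Lambda\subseteq G\times\widehat{G}$, a nonzero $f\in(\mathbb{C}^{o(G)})^*$ and a nonzero $\tau\in\mathbb{C}^{o(G)}$, the pair $(\{f(\pi(\lambda)^{-1})\}_{\lambda\in\Lambda},\{\pi(\lambda)\tau\}_{\lambda\in\Lambda})$ is called a Gabor-Schauder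 frame for $\mathbb{C}^{o(G)}$ if the operator $S_{f,\tau,\Lambda}:\mathbb{C}^{o(G)}\to\mathbb{C}^{o(G)}$, $S_{f,\tau,\Lambda}x=\sum_{\lambda\in\Lambda}f(\pi(\lambda)^{-1}x)\pi(\lambda)\tau$, is invertible. The adjoint subgroup of $\Lambda$ is $\Lambda^0=\{\mu\in G\times\widehat{G}:\pi(\lambda)\pi(\mu)=\pi(\mu)\pi(\lambda)\ \forall\lambda\in\Lambda\}$, which is a subgroup of $G\times\widehat{G}$. Linear independence is that of families indexed by $\Lambda^0$: $\{v_\mu\}_{\mu\in\Lambda^0}$ is linearly independent if $\sum_{\mu\in\Lambda^0}c_\mu v_\mu=0$ with $c_\mu\in\mathbb{C}$ implies $c_\mu=0$ for all $\mu\in\Lambda^0$. *)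

theory Defs
  imports "HOL-Analysis.Analysis" "HOL-Algebra.Group" "HOL-Library.Function_Algebras"
begin

text \<open>
  The finite abelian group is a type \<open>'g\<close> of sort \<open>{finite, ab_group_add}\<close>, and vectors have
  type \<open>(complex, 'g) vec\<close>. The dual group and its product with the group are \<open>HOL-Algebra\<close>
  structures, because characters form a proper subset of a function type.
\<close>

definition additive_group :: "'g::ab_group_add monoid"
  where "additive_group = \<lparr>carrier = UNIV, mult = (+), one = 0\<rparr>"

definition characters :: "('g::ab_group_add \<Rightarrow> complex) set"
  where "characters = {\<xi>. (\<forall>g h. \<xi> (g + h) = \<xi> g * \<xi> h) \<and> (\<forall>g. cmod (\<xi> g) = 1)}"

definition dual_group :: "('g::ab_group_add \<Rightarrow> complex) monoid"
  where "dual_group = \<lparr>carrier = characters, mult = (\<lambda>\<xi> \<eta> g. \<xi> g * \<eta> g), one = (\<lambda>_. 1)\<rparr>"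

definition time_frequency_group :: "('g::ab_group_add \<times> ('g \<Rightarrow> complex)) monoid"
  where "time_frequency_group = additive_group \<times>\<times> dual_group"

definition tf_shift :: "'g::{finite,ab_group_add} \<times> ('g \<Rightarrow> complex) \<Rightarrow> (complex, 'g) vec \<Rightarrow> (complex, 'g) vec"
  where "tf_shift = (\<lambda>(k, \<xi>) x. \<chi> g. \<xi> g * x $ (g - k))"

text \<open>
  \<open>inv_into UNIV\<close> is the inverse function; its usual notation \<open>inv\<close> is also the group inverse
  of \<open>HOL-Algebra\<close>. It is a two-sided inverse of \<open>tf_shift l\<close> for \<open>l\<close> in the carrier, see
  \<open>bij_tf_shift\<close> below.
\<close>

definition tf_shift_inv :: "'g::{finite,ab_group_add} \<times> ('g \<Rightarrow> complex) \<Rightarrow> (complex, 'g) vec \<Rightarrow> (complex, 'g) vec"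
  where "tf_shift_inv l = inv_into UNIV (tf_shift l)"

definition frame_operator ::
    "((complex, 'g) vec \<Rightarrow> complex) \<Rightarrow> (complex, 'g) vec \<Rightarrow> ('g::{finite,ab_group_add} \<times> ('g \<Rightarrow> complex)) set
      \<Rightarrow> (complex, 'g) vec \<Rightarrow> (complex, 'g) vec"
  where "frame_operator f \<tau> \<Lambda> x = (\<Sum>l\<in>\<Lambda>. f (tf_shift_inv l x) *s tf_shift l \<tau>)"

definition gabor_schauder_frame ::
    "((complex, 'g) vec \<Rightarrow> complex) \<Rightarrow> (complex, 'g) vec \<Rightarrow> ('g::{finite,ab_group_add} \<times> ('g \<Rightarrow> complex)) set \<Rightarrow> bool"
  where "gabor_schauder_frame f \<tau> \<Lambda> \<longleftrightarrow>
    f \<noteq> (\<lambda>_. 0) \<and> \<tau> \<noteq> 0 \<and> bij (frame_operator f \<tau> \<Lambda>)"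

definition adjoint_subgroup ::
    "('g::{finite,ab_group_add} \<times> ('g \<Rightarrow> complex)) set \<Rightarrow> ('g \<times> ('g \<Rightarrow> complex)) set"
  where "adjoint_subgroup \<Lambda> = {m \<in> carrier time_frequency_group.
    \<forall>l\<in>\<Lambda>. tf_shift l \<circ> tf_shift m = tf_shift m \<circ> tf_shift l}"

text \<open>
  Linear independence of a family over a finite index set, with respect to a given scalar
  multiplication; unlike \<open>module.independent\<close>, it rules out repeated members.
\<close>

definition independent_family ::
    "(complex \<Rightarrow> 'v \<Rightarrow> 'v) \<Rightarrow> 'i set \<Rightarrow> ('i \<Rightarrow> 'v::comm_monoid_add) \<Rightarrow> bool"
  where "independent_family smul I v \<longleftrightarrow>
    (\<forall>c. (\<Sum>i\<in>I. smul (c i) (v i)) = 0 \<longrightarrow> (\<forall>i\<in>I. c i = 0))"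

text \<open>Scalar multiplication on the dual space; its addition is that of \<open>Function_Algebras\<close>.\<close>

definition functional_scale :: "complex \<Rightarrow> ('v \<Rightarrow> complex) \<Rightarrow> 'v \<Rightarrow> complex"
  where "functional_scale c \<phi> = (\<lambda>x. c * \<phi> x)"


lemma comm_group_additive_group: "comm_group (additive_group :: 'g::ab_group_add monoid)"
  by (rule comm_groupI) (auto simp: additive_group_def algebra_simps intro: exI[of _ "- x" for x])

lemma character_zero: "\<xi> \<in> characters \<Longrightarrow> \<xi> 0 = 1"
proof -
  assume "\<xi> \<in> characters"
  then have "\<xi> (0 + 0) = \<xi> 0 * \<xi> 0" "cmod (\<xi> 0) = 1"
    unfolding characters_def by blast+
  then show ?thesis by auto
qed

lemma comm_group_dual_group: "comm_group (dual_group :: ('g::ab_group_add \<Rightarrow> complex) monoid)"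
proof (rule comm_groupI)
  fix \<xi> :: "'g \<Rightarrow> complex"
  assume *: "\<xi> \<in> carrier dual_group"
  have "\<xi> g \<noteq> 0" for g
    using * by (auto simp: dual_group_def characters_def dest: spec[of _ g])
  then show "\<exists>\<eta>\<in>carrier dual_group. \<eta> \<otimes>\<^bsub>dual_group\<^esub> \<xi> = \<one>\<^bsub>dual_group\<^esub>"
    using * by (intro bexI[of _ "\<lambda>g. inverse (\<xi> g)"])
      (auto simp: dual_group_def characters_def norm_inverse)
qed (auto simp: dual_group_def characters_def norm_mult algebra_simps)

lemma group_time_frequency_group: "group time_frequency_group"
  unfolding time_frequency_group_def
  by (intro DirProd_group comm_group.axioms(2) comm_group_additive_group comm_group_dual_group)

lemma finite_time_frequency_group:
  "finite (carrier (time_frequency_group :: ('g::{finite,ab_group_add} \<times> _) monoid))"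
proof -
  let ?n = "CARD('g)"
  have "\<xi> g ^ ?n = 1" if "\<xi> \<in> characters" for \<xi> and g :: 'g
  proof -
    have nz: "\<xi> h \<noteq> 0" for h
      using that by (auto simp: characters_def dest: spec[of _ h])
    have "(\<Prod>h\<in>UNIV. \<xi> h) = (\<Prod>h\<in>UNIV. \<xi> (g + h))"
      by (rule prod.reindex_bij_witness[of _ "\<lambda>h. g + h" "\<lambda>h. h - g"]) auto
    also have "\<dots> = \<xi> g ^ ?n * (\<Prod>h\<in>UNIV. \<xi> h)"
      using that by (simp add: characters_def prod.distrib)
    finally show ?thesis using nz by simp
  qed
  then have "(characters :: ('g \<Rightarrow> complex) set) \<subseteq> (UNIV \<rightarrow>\<^sub>E {z. z ^ ?n = 1})"
    by auto
  moreover have "finite (UNIV \<rightarrow>\<^sub>E {z::complex. z ^ ?n = 1} :: ('g \<Rightarrow> complex) set)"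
    by (intro finite_PiE) (auto intro: finite_roots_unity)
  ultimately have "finite (characters :: ('g \<Rightarrow> complex) set)"
    by (rule finite_subset)
  then show ?thesis
    by (simp add: time_frequency_group_def additive_group_def dual_group_def DirProd_def finite_cartesian_product)
qed

lemma bij_tf_shift:
  assumes "l \<in> carrier time_frequency_group"
  shows "bij (tf_shift l)"
proof -
  obtain k \<xi> where l: "l = (k, \<xi>)" by force
  then have "\<xi> \<in> characters"
    using assms by (simp add: time_frequency_group_def dual_group_def DirProd_def)
  then have nz: "\<xi> h \<noteq> 0" for h
    by (auto simp: characters_def dest: spec[of _ h])
  show ?thesis
    by (rule o_bij[of "\<lambda>y. \<chi> g. y $ (g + k) / \<xi> (g + k)"])
      (auto simp: l tf_shift_def nz vec_eq_iff)
qed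


end

theory Submission
  imports Defs
begin

text \<open>
  Both claims concern the operators \<open>A = (\<Sum>m\<in>\<Lambda>\<^sup>0. c m \<pi>(m)\<inverse>)\<close>: a linear relation in the first
  family is \<open>A \<tau> = 0\<close>, and one in the second family is \<open>f \<circ> A = 0\<close>. By definition of the adjoint
  subgroup \<open>\<Lambda>\<^sup>0\<close>, \<open>A\<close> commutes with every \<open>\<pi>(l)\<close>, \<open>l \<in> \<Lambda>\<close>. With \<open>S\<close> the frame operator, this gives

  \<^item> \<open>A (S x) = (\<Sum>l\<in>\<Lambda>. f (\<pi>(l)\<inverse> x) \<pi>(l) (A \<tau>))\<close>; so \<open>A \<tau> = 0\<close> implies \<open>A S = 0\<close>, and \<open>A = 0\<close> because
    \<open>S\<close> is onto (\<open>commuting_operator_zero_if_kills_window\<close>);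
  \<^item> \<open>S (A x) = (\<Sum>l\<in>\<Lambda>. f (A (\<pi>(l)\<inverse> x)) \<pi>(l) \<tau>)\<close>; so \<open>f \<circ> A = 0\<close> implies \<open>S A = 0\<close>, and \<open>A = 0\<close> because
    \<open>S\<close> is one-to-one (\<open>commuting_operator_zero_if_functional_kills_range\<close>).

  Finally, time-frequency shifts are linearly independent as operators: they are orthogonal for
  the trace form, by the orthogonality of characters. So \<open>A = 0\<close> forces \<open>c = 0\<close>
  (\<open>shift_combination_zero_imp_coeff_zero\<close>).
\<close>

lemma in_carrier_time_frequency_group:
  "(k, \<xi>) \<in> carrier time_frequency_group \<longleftrightarrow> \<xi> \<in> characters"
  by (simp add: time_frequency_group_def additive_group_def dual_group_def DirProd_def)

lemma character_nonzero: "\<xi> \<in> characters \<Longrightarrow> \<xi> g \<noteq> 0"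
  by (auto simp: characters_def dest: spec[of _ g])

lemma sum_character_quotient:
  fixes \<xi> \<eta> :: "'g::{finite,ab_group_add} \<Rightarrow> complex"
  assumes "\<xi> \<in> characters" "\<eta> \<in> characters"
  shows "(\<Sum>h\<in>UNIV. \<eta> h / \<xi> h) = (if \<xi> = \<eta> then of_nat CARD('g) else 0)"
proof (cases "\<xi> = \<eta>")
  case True
  then show ?thesis using character_nonzero[OF assms(1)] by simp
next
  case False
  then obtain g where g: "\<xi> g \<noteq> \<eta> g" by blast
  \<comment> \<open>Translating the summation variable by \<open>g\<close> multiplies the sum by \<open>\<eta> g / \<xi> g \<noteq> 1\<close>.\<close>
  have "(\<Sum>h\<in>UNIV. \<eta> h / \<xi> h) = (\<Sum>h\<in>UNIV. \<eta> (g + h) / \<xi> (g + h))"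
    by (rule sum.reindex_bij_witness[of _ "\<lambda>h. g + h" "\<lambda>h. h - g"]) auto
  also have "\<dots> = \<eta> g / \<xi> g * (\<Sum>h\<in>UNIV. \<eta> h / \<xi> h)"
    using assms by (simp add: characters_def sum_distrib_left)
  finally have "(\<Sum>h\<in>UNIV. \<eta> h / \<xi> h) = 0"
    using g character_nonzero[OF assms(1), of g] by (auto simp: field_simps)
  then show ?thesis using False by simp
qed

lemma tf_shift_inv_nth:
  assumes "(k, \<xi>) \<in> carrier time_frequency_group"
  shows "tf_shift_inv (k, \<xi>) x $ g = x $ (g + k) / \<xi> (g + k)"
proof -
  have nz: "\<xi> h \<noteq> 0" for h
    using assms by (simp add: in_carrier_time_frequency_group character_nonzero)
  have "tf_shift (k, \<xi>) (\<chi> g. x $ (g + k) / \<xi> (g + k)) = x"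
    by (simp add: tf_shift_def nz vec_eq_iff)
  then have "tf_shift_inv (k, \<xi>) x = (\<chi> g. x $ (g + k) / \<xi> (g + k))"
    unfolding tf_shift_inv_def by (intro inv_f_eq bij_is_inj bij_tf_shift assms)
  then show ?thesis by simp
qed

lemma linear_tf_shift: "Vector_Spaces.linear (*s) (*s) (tf_shift l)"
  by (cases l, unfold Vector_Spaces.linear_iff, intro conjI allI vec.vector_space_axioms)
    (simp_all add: tf_shift_def vec_eq_iff algebra_simps)

lemma linear_tf_shift_inv:
  assumes "l \<in> carrier time_frequency_group"
  shows "Vector_Spaces.linear (*s) (*s) (tf_shift_inv l)"
  using assms
  by (cases l, unfold Vector_Spaces.linear_iff, intro conjI allI vec.vector_space_axioms)
    (simp_all add: vec_eq_iff tf_shift_inv_nth add_divide_distrib)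

lemma inverse_commutes_if_commutes:
  assumes "bij p" and "p \<circ> q = q \<circ> p"
  shows "inv_into UNIV p (q x) = q (inv_into UNIV p x)"
proof (rule inv_f_eq)
  show "inj p" using assms(1) by (rule bij_is_inj)
  have "p (q (inv_into UNIV p x)) = q (p (inv_into UNIV p x))"
    using fun_cong[OF assms(2)] by simp
  then show "p (q (inv_into UNIV p x)) = q x"
    using assms(1) by (simp add: bij_is_surj surj_f_inv_f)
qed

definition shift_combination ::
    "('g::{finite,ab_group_add} \<times> ('g \<Rightarrow> complex)) set \<Rightarrow> ('g \<times> ('g \<Rightarrow> complex) \<Rightarrow> complex)
      \<Rightarrow> (complex, 'g) vec \<Rightarrow> (complex, 'g) vec"
  where "shift_combination M c x = (\<Sum>m\<in>M. c m *s tf_shift_inv m x)"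

lemma linear_shift_combination:
  assumes "M \<subseteq> carrier time_frequency_group"
  shows "Vector_Spaces.linear (*s) (*s) (shift_combination M c)"
proof -
  have "Vector_Spaces.linear (*s) (*s) (\<lambda>x. \<Sum>m\<in>M. c m *s tf_shift_inv m x)"
    using assms
    by (intro vec.linear_compose_sum ballI vec.linear_compose_scale_right linear_tf_shift_inv) auto
  then show ?thesis
    unfolding shift_combination_def[abs_def] .
qed

text \<open>
  The coefficient at \<open>(k, \<eta>)\<close> is recovered, up to the factor \<open>CARD('g)\<close>, as the trace of the combination
  followed by \<open>\<pi>(k, \<eta>)\<close>: the basis vector at \<open>h\<close> is moved to \<open>h - k\<close> exactly by the terms with
  translation part \<open>k\<close>, and summing over \<open>h\<close> then singles out the modulation part \<open>\<eta>\<close> by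
  orthogonality of characters.
\<close>

lemma shift_combination_zero_imp_coeff_zero:
  fixes M :: "('g::{finite,ab_group_add} \<times> ('g \<Rightarrow> complex)) set"
  assumes M: "M \<subseteq> carrier time_frequency_group"
    and zero: "\<And>x. shift_combination M c x = 0"
    and m: "m \<in> M"
  shows "c m = 0"
proof -
  have fin: "finite M"
    using M finite_time_frequency_group finite_subset by blast
  obtain k \<eta> where k\<eta>: "m = (k, \<eta>)" by force
  have \<eta>: "\<eta> \<in> characters"
    using M m k\<eta> in_carrier_time_frequency_group by blast
  have trace: "(\<Sum>h\<in>UNIV. \<eta> h * tf_shift_inv n (axis h 1) $ (h - k)) =
      (if n = m then of_nat CARD('g) else 0)" if n: "n \<in> M" for n
  proof -
    obtain j \<xi> where j\<xi>: "n = (j, \<xi>)" by force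
    have car: "(j, \<xi>) \<in> carrier time_frequency_group"
      using M n j\<xi> by blast
    have \<xi>: "\<xi> \<in> characters"
      using car in_carrier_time_frequency_group by blast
    have "\<eta> h * tf_shift_inv n (axis h 1) $ (h - k) = (if j = k then \<eta> h / \<xi> h else 0)" for h
      using tf_shift_inv_nth[OF car] by (auto simp: j\<xi> axis_def algebra_simps)
    then have "(\<Sum>h\<in>UNIV. \<eta> h * tf_shift_inv n (axis h 1) $ (h - k)) =
        (if j = k then \<Sum>h\<in>UNIV. \<eta> h / \<xi> h else 0)"
      by (cases "j = k") (simp_all only: if_True if_False simp_thms sum.neutral_const)
    then show ?thesis
      by (simp only: sum_character_quotient[OF \<xi> \<eta>] j\<xi> k\<eta> prod.inject if_if_eq_conj)
  qed
  have "0 = (\<Sum>h\<in>UNIV. \<eta> h * shift_combination M c (axis h 1) $ (h - k))"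
    by (simp add: zero)
  also have "\<dots> = (\<Sum>n\<in>M. c n * (\<Sum>h\<in>UNIV. \<eta> h * tf_shift_inv n (axis h 1) $ (h - k)))"
    unfolding shift_combination_def sum_component sum_distrib_left
    by (subst sum.swap) (simp add: algebra_simps)
  also have "\<dots> = (\<Sum>n\<in>M. if n = m then c n * of_nat CARD('g) else 0)"
    by (intro sum.cong refl) (simp add: trace)
  also have "\<dots> = c m * of_nat CARD('g)"
    using fin m by simp
  finally show ?thesis by simp
qed

lemma shift_combination_adjoint_commutes:
  assumes \<Lambda>: "\<Lambda> \<subseteq> carrier time_frequency_group" and l: "l \<in> \<Lambda>"
  shows "shift_combination (adjoint_subgroup \<Lambda>) c (tf_shift l x) =
    tf_shift l (shift_combination (adjoint_subgroup \<Lambda>) c x)"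
proof -
  interpret T: Vector_Spaces.linear "(*s)" "(*s)" "tf_shift l"
    by (rule linear_tf_shift)
  have "tf_shift_inv m (tf_shift l x) = tf_shift l (tf_shift_inv m x)"
    if "m \<in> adjoint_subgroup \<Lambda>" for m
    unfolding tf_shift_inv_def
    using that l by (intro inverse_commutes_if_commutes bij_tf_shift) (simp_all add: adjoint_subgroup_def)
  then show ?thesis
    by (simp add: shift_combination_def T.sum T.scale)
qed

text \<open>
  The range of the frame operator lies in the span of the shifts of the window, and an operator that
  commutes with these shifts and kills the window kills all of them.
\<close>

lemma commuting_operator_zero_if_kills_window:
  assumes surj: "surj (frame_operator f \<tau> \<Lambda>)"
    and A: "Vector_Spaces.linear (*s) (*s) A"
    and comm: "\<And>l x. l \<in> \<Lambda> \<Longrightarrow> A (tf_shift l x) = tf_shift l (A x)"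
    and kills: "A \<tau> = 0"
  shows "A y = 0"
proof -
  interpret A: Vector_Spaces.linear "(*s)" "(*s)" A by (rule A)
  obtain x where "y = frame_operator f \<tau> \<Lambda> x"
    using surj by (auto simp: surj_def)
  moreover have "tf_shift l 0 = 0" for l :: "'a \<times> ('a \<Rightarrow> complex)"
    by (cases l) (simp add: tf_shift_def vec_eq_iff)
  ultimately show ?thesis
    by (simp add: frame_operator_def A.sum A.scale comm kills)
qed

text \<open>
  The dual argument: the frame operator sees a vector only through the values of \<open>f\<close> at its
  inverse shifts, and on the range of \<open>A\<close> these are again values of \<open>f\<close> on the range of \<open>A\<close>.
\<close>

lemma commuting_operator_zero_if_functional_kills_range:
  assumes inj: "inj (frame_operator f \<tau> \<Lambda>)"
    and \<Lambda>: "\<Lambda> \<subseteq> carrier time_frequency_group"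
    and A: "Vector_Spaces.linear (*s) (*s) A"
    and comm: "\<And>l x. l \<in> \<Lambda> \<Longrightarrow> A (tf_shift l x) = tf_shift l (A x)"
    and kills: "\<And>x. f (A x) = 0"
  shows "A x = 0"
proof -
  interpret A: Vector_Spaces.linear "(*s)" "(*s)" A by (rule A)
  have inv: "tf_shift_inv l (A x) = A (tf_shift_inv l x)" if "l \<in> \<Lambda>" for l x
    unfolding tf_shift_inv_def
    using that \<Lambda> comm by (intro inverse_commutes_if_commutes bij_tf_shift) (auto simp: fun_eq_iff)
  have "frame_operator f \<tau> \<Lambda> (A x) = 0" for x
    by (simp add: frame_operator_def inv kills)
  then have "A x = A 0"
    using inj by (metis injD)
  then show ?thesis by simp
qed

theorem theorem3p10:
  fixes \<Lambda> :: "('g::{finite,ab_group_add} \<times> ('g \<Rightarrow> complex)) set"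
    and \<tau> :: "(complex, 'g) vec"
    and f :: "(complex, 'g) vec \<Rightarrow> complex"
  assumes "subgroup \<Lambda> time_frequency_group"
    and "Vector_Spaces.linear (*s) (*) f"
    and "gabor_schauder_frame f \<tau> \<Lambda>"
  shows "independent_family (*s) (adjoint_subgroup \<Lambda>) (\<lambda>m. tf_shift_inv m \<tau>) \<and>
    independent_family functional_scale (adjoint_subgroup \<Lambda>) (\<lambda>m x. f (tf_shift_inv m x))"
proof -
  interpret f: Vector_Spaces.linear "(*s)" "(*)" f by (rule assms(2))
  let ?A = "shift_combination (adjoint_subgroup \<Lambda>)"
  have \<Lambda>: "\<Lambda> \<subseteq> carrier time_frequency_group"
    using assms(1) by (rule subgroup.subset)
  have M: "adjoint_subgroup \<Lambda> \<subseteq> carrier time_frequency_group"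
    by (auto simp: adjoint_subgroup_def)
  have bij: "bij (frame_operator f \<tau> \<Lambda>)"
    using assms(3) by (simp add: gabor_schauder_frame_def)
  note lin = linear_shift_combination[OF M]
  note comm = shift_combination_adjoint_commutes[OF \<Lambda>]
  note coeff = shift_combination_zero_imp_coeff_zero[OF M]
  show ?thesis
  proof
    show "independent_family (*s) (adjoint_subgroup \<Lambda>) (\<lambda>m. tf_shift_inv m \<tau>)"
      unfolding independent_family_def
    proof (intro allI impI ballI)
      fix c m
      assume "(\<Sum>i\<in>adjoint_subgroup \<Lambda>. c i *s tf_shift_inv i \<tau>) = 0"
      then have kills: "?A c \<tau> = 0"
        by (simp add: shift_combination_def)
      have "?A c x = 0" for x
        using commuting_operator_zero_if_kills_window[OF bij_is_surj[OF bij] lin comm kills] .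
      moreover assume "m \<in> adjoint_subgroup \<Lambda>"
      ultimately show "c m = 0" by (rule coeff)
    qed
  next
    show "independent_family functional_scale (adjoint_subgroup \<Lambda>) (\<lambda>m x. f (tf_shift_inv m x))"
      unfolding independent_family_def
    proof (intro allI impI ballI)
      fix c m
      assume zero: "(\<Sum>i\<in>adjoint_subgroup \<Lambda>. functional_scale (c i) (\<lambda>x. f (tf_shift_inv i x))) = 0"
      have sum_apply: "(\<Sum>i\<in>I. g i) x = (\<Sum>i\<in>I. g i x)"
        for I and g :: "'g \<times> ('g \<Rightarrow> complex) \<Rightarrow> (complex, 'g) vec \<Rightarrow> complex" and x
        by (induction I rule: infinite_finite_induct) auto
      have kills: "f (?A c x) = 0" for x
        using fun_cong[OF zero, of x]
        by (simp add: sum_apply functional_scale_def shift_combination_def f.sum f.scale)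
      have "?A c x = 0" for x
        using commuting_operator_zero_if_functional_kills_range
          [OF bij_is_inj[OF bij] \<Lambda> lin comm kills] .
      moreover assume "m \<in> adjoint_subgroup \<Lambda>"
      ultimately show "c m = 0" by (rule coeff)
    qed
  qed
qed

end
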